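(* Consider directed walks with jumps $-2$ and $+5$ that stay at nonnegative altitude. Let $F_0(z)=\sum_{n\ge 0} f_n z^n$, where $f_n$ is the number of such walks with $n$ jumps starting at altitude $3$ and ending at altitude $0$, and let $G_1(z)=\sum_{n\ge0} g_n z^n$, where $g_n$ is the number of such walks with $n$ jumps starting at altitude $4$ and ending at altitude $1$. Let $u_1(z),u_2(z)$ be the two small roots of the equation $1-zP(u)=0$, where $P(u)=u^{-2}+u^5$. Then $$F_0(z) = -\frac{u_1u_2\,(u_1^4-u_2^4)}{z\,(u_1-u_2)},\qquad G_1(z)=\frac{u_1^6-u_2^6}{z\,(u_1-u_2)}.$$
   Context: A walk with $n$ jumps starting at altitude $h$ is a sequence of integers $(h_0,\dots,h_n)$ with $h_0=h$ and $h_i-h_{i-1}\in\{-2,+5\}$ for each $i$; here all $h_i\ge 0$ is required (altitude $0$ may be touched). Equivalently, it is a lattice path in $\mathbb{N}^2$ (with $0\in\mathbb{N}$) with steps $(1,-2)$ and $(1,5)$. The equation $1-zP(u)=0$ is equivalent to $u^2=z(1+u^7)$, which has $7$ solutions $u=u(z)$ as Puiseux series at $z=0$; the small roots are the two that tend to $0$ as $z\to0$ (they are power series in $z^{1/2}$, with leading terms $z^{1/2}$ and $-z^{1/2}$); the other five tend to infinity. *)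

theory Defs
  imports "HOL-Computational_Algebra.Computational_Algebra" Complex_Main
begin

definition walks :: "nat \<Rightarrow> int \<Rightarrow> int \<Rightarrow> int list set" where
  "walks n a b = {hs. length hs = Suc n \<and> hs ! 0 = a \<and> hs ! n = b \<and>
     (\<forall>i\<le>n. 0 \<le> hs ! i) \<and> (\<forall>i<n. hs ! Suc i - hs ! i \<in> {-2, 5})}"

text \<open>The cardinality below is a genuine count:\<close>

lemma finite_walks: "finite (walks n a b)"
proof (rule finite_subset)
  show "walks n a b \<subseteq> {hs. set hs \<subseteq> {0..a + 5 * int n} \<and> length hs = Suc n}"
  proof
    fix hs assume "hs \<in> walks n a b"
    then have len: "length hs = Suc n" and h0: "hs ! 0 = a"
      and nn: "\<forall>i\<le>n. 0 \<le> hs ! i"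
      and st: "\<forall>i<n. hs ! Suc i - hs ! i \<in> {-2, 5}"
      by (auto simp: walks_def)
    have le: "i \<le> n \<Longrightarrow> hs ! i \<le> a + 5 * int i" for i
    proof (induction i)
      case (Suc i)
      then show ?case using st[rule_format, of i] by auto
    qed (simp add: h0)
    have "x \<in> {0..a + 5 * int n}" if "x \<in> set hs" for x
    proof -
      from that len obtain i where "i \<le> n" "x = hs ! i"
        by (metis in_set_conv_nth less_Suc_eq_le)
      then show ?thesis using le[of i] nn by auto
    qed
    then show "hs \<in> {hs. set hs \<subseteq> {0..a + 5 * int n} \<and> length hs = Suc n}"
      using len by auto
  qed
  show "finite {hs. set hs \<subseteq> {0..a + 5 * int n} \<and> length hs = Suc n}"
    by (rule finite_lists_length_eq) simp
qed

definition walk_gf :: "int \<Rightarrow> int \<Rightarrow> complex fps" where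
  "walk_gf a b = Abs_fps (\<lambda>n. of_nat (card (walks n a b)))"

definition jump_poly :: "complex fls \<Rightarrow> complex fls" where
  "jump_poly u = u powi (-2) + u ^ 5"

text \<open>
  A Puiseux series at \<open>z = 0\<close> with ramification \<open>d > 0\<close> is a Laurent series in
  \<open>t = z\<^sup>1\<^sup>/\<^sup>d\<close>, so it is represented by an element of \<^typ>\<open>complex fls\<close> whose
  variable \<open>fls_X\<close> stands for \<open>t\<close>; finitely many Puiseux series always have a common \<open>d\<close>.
  In this representation \<open>z\<close> is \<open>fls_X ^ d\<close>, and a power series \<open>f(z)\<close> becomes \<open>f(t\<^sup>d)\<close>.
\<close>

definition puiseux_z :: "nat \<Rightarrow> complex fls" where
  "puiseux_z d = fls_X ^ d"

definition puiseux_of_fps :: "nat \<Rightarrow> complex fps \<Rightarrow> complex fls" where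
  "puiseux_of_fps d f = fls_compose_power (fps_to_fls f) d"

text \<open>A Puiseux series tends to \<open>0\<close> as \<open>z \<rightarrow> 0\<close> iff it has only positive exponents.\<close>

definition small_roots :: "nat \<Rightarrow> complex fls set" where
  "small_roots d = {u. 1 - puiseux_z d * jump_poly u = 0 \<and> (\<forall>k\<le>0. fls_nth u k = 0)}"

lemma small_roots_iff:
  "u \<in> small_roots d \<longleftrightarrow>
    u \<noteq> 0 \<and> u ^ 2 = puiseux_z d * (1 + u ^ 7) \<and> (\<forall>k\<le>0. fls_nth u k = 0)"
proof (cases "u = 0")
  case True
  then show ?thesis by (simp add: small_roots_def jump_poly_def)
next
  case False
  have "1 - puiseux_z d * jump_poly u = (u ^ 2 - puiseux_z d * (1 + u ^ 7)) / u ^ 2"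
    using False by (simp add: jump_poly_def power_int_minus field_simps flip: power_add)
  also have "\<dots> = 0 \<longleftrightarrow> u ^ 2 = puiseux_z d * (1 + u ^ 7)"
    using False by simp
  finally show ?thesis using False unfolding small_roots_def by blast
qed

text \<open>
  Sanity check: with \<open>d = 2\<close> there are exactly two small roots, with leading terms
  \<open>t = z\<^sup>1\<^sup>/\<^sup>2\<close> and \<open>-t\<close>.
\<close>

lemma small_roots_2:
  "\<exists>u1 u2. small_roots 2 = {u1, u2} \<and> u1 \<noteq> u2 \<and> fls_nth u1 1 = 1 \<and> fls_nth u2 1 = -1"
proof -
  define s :: "complex fps" where "s = fps_radical (\<lambda>_ _. 1) (Suc 1) (1 + fps_X ^ 7)"
  have s2: "s ^ 2 = 1 + fps_X ^ 7"
    using power_radical[of "1 + fps_X ^ 7 :: complex fps" "\<lambda>_ _. 1" 1]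
    by (simp add: s_def numeral_2_eq_2)
  have s0: "s $ 0 = 1" by (simp add: s_def)
  define w where "w = fps_X * inverse s"
  have w0: "w $ 0 = 0" by (simp add: w_def)
  have w1: "w $ 1 = 1" by (simp add: w_def s0)
  define v where "v = fps_inv w"
  have v0: "v $ 0 = 0" by (simp add: v_def fps_inv_def)
  have v1: "v $ 1 = 1" using w1 by (simp add: v_def fps_inv_def)
  have wv: "w oo v = fps_X" unfolding v_def by (rule fps_inv_right) (use w0 w1 in auto)
  have vw: "v oo w = fps_X" unfolding v_def by (rule fps_inv) (use w0 w1 in auto)
  have wc: "w oo f = f * inverse (s oo f)" if "f $ 0 = 0" for f
    using that s0 by (simp add: w_def fps_compose_mult_distrib fps_inverse_compose)
  have sc: "(s oo f) ^ 2 = 1 + f ^ 7" if "f $ 0 = 0" for f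
    using that by (simp add: fps_compose_power s2 fps_compose_add_distrib fps_X_power_compose)
  have sc0: "(s oo f) $ 0 = 1" for f by (simp only: fps_compose_nth_0 s0)
  have cancel: "inverse (s oo f) * (s oo f) = 1" for f
    by (rule inverse_mult_eq_1) (simp only: sc0, simp)
  have key: "f ^ 2 = fps_X ^ 2 * (1 + f ^ 7) \<longleftrightarrow> f = v \<or> f = v oo (- fps_X)"
    if f0: "f $ 0 = 0" for f
  proof -
    let ?i = "inverse (s oo f)"
    have "f ^ 2 = fps_X ^ 2 * (1 + f ^ 7) \<longleftrightarrow> (w oo f) ^ 2 = fps_X ^ 2"
    proof
      assume "f ^ 2 = fps_X ^ 2 * (1 + f ^ 7)"
      then have "f ^ 2 = fps_X ^ 2 * (s oo f) ^ 2" using sc[OF f0] by simp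
      then have "(w oo f) ^ 2 = fps_X ^ 2 * (?i * (s oo f)) ^ 2"
        by (simp add: wc[OF f0] power_mult_distrib mult_ac)
      then show "(w oo f) ^ 2 = fps_X ^ 2" by (simp add: cancel)
    next
      assume a: "(w oo f) ^ 2 = fps_X ^ 2"
      have "(w oo f) * (s oo f) = f"
        using cancel[of f] by (simp add: wc[OF f0] mult.assoc)
      then have "f ^ 2 = (w oo f) ^ 2 * (s oo f) ^ 2" by (metis power_mult_distrib)
      then show "f ^ 2 = fps_X ^ 2 * (1 + f ^ 7)" using a sc[OF f0] by simp
    qed
    also have "\<dots> \<longleftrightarrow> w oo f = fps_X \<or> w oo f = - fps_X"
      by (rule power2_eq_iff)
    also have "\<dots> \<longleftrightarrow> f = v \<or> f = v oo (- fps_X)"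
    proof -
      have 1: "f = v oo g" if "w oo f = g" for g
      proof -
        have "v oo (w oo f) = f"
          using fps_compose_assoc[of f w v] f0 w0 vw by simp
        then show ?thesis using that by simp
      qed
      have 2: "w oo (v oo g) = g" if "g $ 0 = 0" for g
        using fps_compose_assoc[of g v w] that v0 wv by simp
      show ?thesis using 1[of fps_X] 1[of "- fps_X"] 2[of fps_X] 2[of "- fps_X"] by auto
    qed
    finally show ?thesis .
  qed
  define v' where "v' = v oo (- fps_X)"
  have v'0: "v' $ 0 = 0" by (simp add: v'_def v0)
  have v'1: "v' $ 1 = -1"
    using fps_compose_linear[of v "-1"] v1 by (simp add: v'_def fps_const_neg[symmetric] del: fps_const_neg)
  have "small_roots 2 = {fps_to_fls v, fps_to_fls v'}"
  proof (intro set_eqI iffI)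
    fix u assume "u \<in> small_roots 2"
    then have u: "u ^ 2 = puiseux_z 2 * (1 + u ^ 7)" and uk: "\<forall>k\<le>0. fls_nth u k = 0"
      by (simp_all add: small_roots_iff)
    define f where "f = fls_regpart u"
    have uf: "u = fps_to_fls f"
      using uk by (intro fls_eqI) (auto simp: f_def)
    have f0: "f $ 0 = 0" using uk by (simp add: f_def)
    have "fps_to_fls (f ^ 2) = fps_to_fls (fps_X ^ 2 * (1 + f ^ 7))"
      using u by (simp add: uf puiseux_z_def fps_to_fls_power fls_times_fps_to_fls)
    then have "f ^ 2 = fps_X ^ 2 * (1 + f ^ 7)" by (simp only: fps_to_fls_eq_iff)
    with key[OF f0] show "u \<in> {fps_to_fls v, fps_to_fls v'}" by (auto simp: uf v'_def)
  next
    fix u assume "u \<in> {fps_to_fls v, fps_to_fls v'}"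
    then obtain f where uf: "u = fps_to_fls f" and f: "f = v \<or> f = v'" by auto
    have f0: "f $ 0 = 0" and fn: "f \<noteq> 0" using f v0 v'0 v1 v'1 by auto
    have "f ^ 2 = fps_X ^ 2 * (1 + f ^ 7)" using key[OF f0] f by (auto simp: v'_def)
    then have "fps_to_fls (f ^ 2) = fps_to_fls (fps_X ^ 2 * (1 + f ^ 7))" by simp
    then show "u \<in> small_roots 2"
      using f0 fn by (auto simp: small_roots_iff uf puiseux_z_def fps_to_fls_power fls_times_fps_to_fls)
  qed
  moreover have "fls_nth (fps_to_fls v) 1 = 1" "fls_nth (fps_to_fls v') 1 = -1" using v1 v'1 by auto
  moreover from this have "fps_to_fls v \<noteq> fps_to_fls v'" by auto
  ultimately show ?thesis by blast
qed

end

(* The kernel method, without infinite sums.  Let W_n be the altitude generating function of the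
   walks with n jumps, and u a small root, u^2 = z (1 + u^7).  Recording the last jump gives
   u^2 W_(n+1)(u) = (1 + u^7) W_n(u) - w_n(0) - u w_n(1), hence the remainders
   R_N = u^2 W_N(u) - z (T_N + u T'_N), with T_N and T'_N the N-th tails of the series counting
   the walks ending at 0 and 1, satisfy R_N = z R_(N+1).  Thus R_0 is divisible by every power
   of z and vanishes: u^(a+2) = z (F_0 + u F_1).  The two small roots give two linear equations
   in F_0 and F_1. *)
theory Submission
  imports Defs
begin

lemma walks_0: "walks 0 a b = (if a = b \<and> 0 \<le> b then {[b]} else {})"
  by (auto simp: walks_def length_Suc_conv)

text \<open>Covers the predecessor altitude \<open>b - 5\<close> when it is negative, so that the
  count by last jump needs no case distinction.\<close>

lemma walks_neg: "b < 0 \<Longrightarrow> walks n a b = {}"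
  by (auto simp: walks_def)

lemma walks_Suc:
  assumes "0 \<le> b"
  shows "walks (Suc n) a b = (\<lambda>hs. hs @ [b]) ` (walks n a (b + 2) \<union> walks n a (b - 5))"
proof (intro set_eqI iffI)
  fix hs assume hs: "hs \<in> walks (Suc n) a b"
  then have len: "length hs = Suc (Suc n)"
    and st: "\<forall>i<Suc n. hs ! Suc i - hs ! i \<in> {-2, 5}"
    and last: "hs ! Suc n = b" by (auto simp: walks_def)
  have split: "hs = take (Suc n) hs @ [b]"
    using len last take_Suc_conv_app_nth[of "Suc n" hs] by simp
  have "hs ! n = b + 2 \<or> hs ! n = b - 5"
    using st[rule_format, of n] last by auto
  moreover have "take (Suc n) hs \<in> walks n a (hs ! n)"
    using hs by (auto simp: walks_def)
  ultimately show "hs \<in> (\<lambda>hs. hs @ [b]) ` (walks n a (b + 2) \<union> walks n a (b - 5))"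
    using split by auto
next
  fix hs assume "hs \<in> (\<lambda>hs. hs @ [b]) ` (walks n a (b + 2) \<union> walks n a (b - 5))"
  then obtain gs c where hs: "hs = gs @ [b]" and gs: "gs \<in> walks n a c" and "c = b + 2 \<or> c = b - 5"
    by blast
  have "hs ! Suc i - hs ! i \<in> {-2, 5}" if "i < Suc n" for i
    using that gs \<open>c = b + 2 \<or> c = b - 5\<close>
    by (cases "i = n") (auto simp: hs walks_def nth_append)
  then show "hs \<in> walks (Suc n) a b"
    using assms gs by (auto simp: hs walks_def nth_append)
qed

lemma card_walks_Suc:
  assumes "0 \<le> b"
  shows "card (walks (Suc n) a b) = card (walks n a (b + 2)) + card (walks n a (b - 5))"
proof -
  have "walks n a (b + 2) \<inter> walks n a (b - 5) = {}"
    by (auto simp: walks_def)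
  then show ?thesis
    using assms by (simp add: walks_Suc card_image inj_on_def card_Un_disjoint finite_walks)
qed

text \<open>Here the variable marks the final altitude; in \<open>walk_gf\<close> it marks the
  number of jumps.\<close>

definition altitude_gf :: "int \<Rightarrow> nat \<Rightarrow> complex fps" where
  "altitude_gf a n = Abs_fps (\<lambda>b. of_nat (card (walks n a (int b))))"

lemma altitude_gf_0: "altitude_gf (int a) 0 = fps_X ^ a"
  by (rule fps_ext) (auto simp: altitude_gf_def walks_0)

text \<open>The factor \<open>fps_X ^ 2\<close> avoids negative powers. The subtracted terms are the
  walks at altitudes 0 and 1, where the jump -2 is forbidden.\<close>

lemma altitude_gf_Suc:
  "fps_X ^ 2 * altitude_gf a (Suc n) =
     (1 + fps_X ^ 7) * altitude_gf a n
     - fps_const (walk_gf a 0 $ n) - fps_const (walk_gf a 1 $ n) * fps_X"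
proof (rule fps_ext)
  fix k :: nat
  consider "k = 0" | "k = 1" | b where "k = b + 2"
    by (metis One_nat_def Suc_eq_plus1 add_2_eq_Suc' not0_implies_Suc)
  then show "(fps_X ^ 2 * altitude_gf a (Suc n)) $ k =
     ((1 + fps_X ^ 7) * altitude_gf a n
      - fps_const (walk_gf a 0 $ n) - fps_const (walk_gf a 1 $ n) * fps_X) $ k"
  proof cases
    case 3
    have "card (walks (Suc n) a (int b)) = card (walks n a (int b + 2)) +
        (if b < 5 then 0 else card (walks n a (int (b - 5))))"
      by (simp add: card_walks_Suc walks_neg of_nat_diff)
    with 3 show ?thesis
      by (simp add: altitude_gf_def fps_X_power_mult_nth distrib_right add.commute)
  qed (simp_all add: altitude_gf_def walk_gf_def fps_X_power_mult_nth distrib_right)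
qed

lemma fps_eq_0_if_divisible_sequence:
  fixes R :: "nat \<Rightarrow> 'a :: idom fps"
  assumes "d > 0" and R: "\<And>n. R n = fps_X ^ d * R (Suc n)"
  shows "R 0 = 0"
proof (rule fps_ext)
  fix k
  have "R 0 = fps_X ^ (d * n) * R n" for n
  proof (induction n)
    case (Suc n)
    then have "R 0 = fps_X ^ (d * n) * (fps_X ^ d * R (Suc n))"
      using R[of n] by metis
    then show ?case by (simp add: power_add ac_simps)
  qed simp
  \<comment> \<open>\<open>Suc k\<close> iterations suffice: \<open>d > 0\<close> gives
    \<open>d * Suc k > k\<close>.\<close>
  from this[of "Suc k"] have "R 0 $ k = (if k < d * Suc k then 0 else R (Suc k) $ (k - d * Suc k))"
    by (metis fps_X_power_mult_nth)
  moreover have "1 * Suc k \<le> d * Suc k"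
    using \<open>d > 0\<close> by (intro mult_le_mono1) simp
  ultimately show "R 0 $ k = 0 $ k"
    by (simp add: Suc_le_eq)
qed

lemma kernel_equation:
  fixes u :: "complex fps"
  assumes d: "d > 0" and u0: "u $ 0 = 0" and u: "u ^ 2 = fps_X ^ d * (1 + u ^ 7)"
  shows "u ^ (a + 2) = fps_X ^ d *
    ((walk_gf (int a) 0 oo fps_X ^ d) + u * (walk_gf (int a) 1 oo fps_X ^ d))"
proof -
  define z :: "complex fps" where "z = fps_X ^ d"
  have z0: "z $ 0 = 0" using d by (simp add: z_def)
  \<comment> \<open>Substituting \<open>u\<close> for the altitude variable is legitimate because
    \<open>u $ 0 = 0\<close>.\<close>
  define W where "W n = altitude_gf (int a) n oo u" for n
  define w where "w b n = fps_const (walk_gf (int a) b $ n)" for b n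
  \<comment> \<open>The shift divides the tail from index \<open>n\<close> on by
    \<open>z ^ n\<close>.\<close>
  define T where "T b n = fps_shift n (walk_gf (int a) b) oo z" for b n
  define R where "R n = u ^ 2 * W n - z * (T 0 n + u * T 1 n)" for n
  have W: "u ^ 2 * W (Suc n) = (1 + u ^ 7) * W n - w 0 n - w 1 n * u" for n
    using arg_cong[OF altitude_gf_Suc[of "int a" n], of "\<lambda>f. f oo u"] u0
    by (simp add: W_def w_def fps_compose_mult_distrib fps_compose_add_distrib
          fps_compose_sub_distrib fps_X_power_compose)
  have T: "T b n = w b n + z * T b (Suc n)" for b n
  proof -
    have "fps_shift n (walk_gf (int a) b) =
        fps_const (walk_gf (int a) b $ n) + fps_X * fps_shift (Suc n) (walk_gf (int a) b)"
      by (rule fps_ext) (auto simp: gr0_conv_Suc)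
    then show ?thesis
      using z0 by (simp add: T_def w_def fps_compose_mult_distrib fps_compose_add_distrib)
  qed
  \<comment> \<open>The kernel equation turns \<open>u ^ 2 * W n\<close> into
    \<open>z * (1 + u ^ 7) * W n\<close>; the boundary terms of \<open>W\<close> then cancel the
    leading terms of \<open>T 0 n\<close> and \<open>T 1 n\<close>.\<close>
  have "R n = z * R (Suc n)" for n
  proof -
    have "R n = z * ((1 + u ^ 7) * W n) - z * (T 0 n + u * T 1 n)"
      by (simp add: R_def u z_def mult.assoc)
    also have "(1 + u ^ 7) * W n = u ^ 2 * W (Suc n) + w 0 n + w 1 n * u"
      using W[of n] by simp
    finally show ?thesis
      by (simp add: R_def T[of _ n] algebra_simps)
  qed
  then have "R 0 = 0"
    unfolding z_def by (rule fps_eq_0_if_divisible_sequence[OF d])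
  moreover have "W 0 = u ^ a"
    using u0 by (simp add: W_def altitude_gf_0 fps_X_power_compose)
  then have "R 0 = u ^ (a + 2) - z * ((walk_gf (int a) 0 oo z) + u * (walk_gf (int a) 1 oo z))"
    by (simp only: R_def T_def fps_shift_0 power_add mult.commute[of "u ^ a"])
  ultimately show ?thesis
    by (simp only: z_def right_minus_eq)
qed

text \<open>Having only positive exponents, a small root is a power series in t without constant
  term, so \<open>kernel_equation\<close> carries over along \<open>fps_to_fls\<close>.\<close>

lemma small_root_equation:
  assumes d: "d > 0" and "u \<in> small_roots d"
  shows "u ^ (a + 2) = puiseux_z d *
    (puiseux_of_fps d (walk_gf (int a) 0) + u * puiseux_of_fps d (walk_gf (int a) 1))"
proof -
  from assms have u: "u ^ 2 = puiseux_z d * (1 + u ^ 7)" and uk: "\<forall>k\<le>0. fls_nth u k = 0"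
    by (simp_all add: small_roots_iff)
  define f where "f = fls_regpart u"
  have uf: "u = fps_to_fls f"
    using uk by (intro fls_eqI) (auto simp: f_def)
  have f0: "f $ 0 = 0" using uk by (simp add: f_def)
  have "fps_to_fls (f ^ 2) = fps_to_fls (fps_X ^ d * (1 + f ^ 7))"
    using u by (simp add: uf puiseux_z_def fps_to_fls_power fls_times_fps_to_fls)
  then have "f ^ 2 = fps_X ^ d * (1 + f ^ 7)" by (simp only: fps_to_fls_eq_iff)
  from arg_cong[OF kernel_equation[OF d f0 this, of a], of fps_to_fls] show ?thesis
    using d by (simp add: uf puiseux_z_def puiseux_of_fps_def fls_compose_power_fps_to_fls
        fps_to_fls_power fls_times_fps_to_fls)
qed

text \<open>Cramer's rule with determinant \<open>z ^ 2 * (y - x)\<close>.\<close>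

lemma linear_system_2:
  fixes x y p q z s t :: "'a :: field"
  assumes "x \<noteq> y" "z \<noteq> 0" and "p = z * (s + x * t)" and "q = z * (s + y * t)"
  shows "s = (x * q - y * p) / (z * (x - y))" and "t = (p - q) / (z * (x - y))"
  using assms by (simp_all add: field_simps)

theorem theorem4p1:
  fixes d :: nat and u1 u2 :: "complex fls"
  assumes "d > 0"
    and "u1 \<in> small_roots d" and "u2 \<in> small_roots d" and "u1 \<noteq> u2"
  shows "puiseux_of_fps d (walk_gf 3 0) =
           - (u1 * u2 * (u1 ^ 4 - u2 ^ 4)) / (puiseux_z d * (u1 - u2)) \<and>
         puiseux_of_fps d (walk_gf 4 1) =
           (u1 ^ 6 - u2 ^ 6) / (puiseux_z d * (u1 - u2))"
proof
  have z: "puiseux_z d \<noteq> 0" by (simp add: puiseux_z_def)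
  \<comment> \<open>The right-hand sides \<open>p\<close> and \<open>q\<close> are
    \<open>u1 ^ (a + 2)\<close> and \<open>u2 ^ (a + 2)\<close>, with \<open>a\<close> still free:
    start 3 gives fifth powers, start 4 sixth powers.\<close>
  note system = linear_system_2[OF assms(4) z small_root_equation[OF assms(1,2)]
      small_root_equation[OF assms(1,3)]]
  have "u1 * u2 ^ 5 - u2 * u1 ^ 5 = - (u1 * u2 * (u1 ^ 4 - u2 ^ 4))"
    by (simp add: algebra_simps eval_nat_numeral)
  then show "puiseux_of_fps d (walk_gf 3 0) =
      - (u1 * u2 * (u1 ^ 4 - u2 ^ 4)) / (puiseux_z d * (u1 - u2))"
    using system(1)[of 3] by simp
  show "puiseux_of_fps d (walk_gf 4 1) = (u1 ^ 6 - u2 ^ 6) / (puiseux_z d * (u1 - u2))"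
    using system(2)[of 4] by simp
qed

end
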